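(* The (external) blocking probability of a throughput optimal scheduling scheme is $$P_b^s=\frac{(\lambda T)^N/N!}{\sum_{i=0}^N(\lambda T)^i/i!},$$ where $\lambda$ is the rate of the Poisson process of user requests (per timeslot), $T$ is the number of chunks of the requested file, and $N$ is the maximum number of users that the server can serve concurrently.
   Context: A single server serves a file of $T$ chunks to users. Time is measured in timeslots. User requests, each for the whole file, arrive at the server according to a Poisson process of rate $\lambda$. The server has a buffer that holds at most $N$ users. An arriving request finding fewer than $N$ users in the buffer is admitted and occupies one buffer slot until it departs; a request arriving when $N$ users are already in the buffer is externally blocked and lost. The (external) blocking probability is the steady-state probability that an arriving request is blocked. In each timeslot the server broadcasts at most one (possibly coded) chunk to all active (admitted, not yet departed) users without error. The rank $r_m(t)$ of user $u_m$ is the rank of the matrix of encoding vectors $u_m$ has received up to timeslot $t$; it is $0$ on arrival, and the user departs when it becomes $T$. A scheduling scheme is throughput optimal if every active user receives a new degree of freedom in every timeslot: $r_m(t+1)=r_m(t)+1$ for all active users $u_m$ and all $t$. Service of an admitted user is taken to begin immediately upon arrival, so that under a throughput optimal scheme each admitted user occupies its buffer slot for exactly $T$ time units. *)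

theory Defs
  imports "HOL-Probability.Probability"
begin

text \<open>
  Time is continuous and measured in timeslots; the file consists of \<open>CARD('t)\<close> chunks. On a
  sample path, \<open>A n\<close> is the arrival time of request \<open>n\<close>, and \<open>c s\<close> is the encoding vector of the
  chunk broadcast in timeslot \<open>s\<close>, or \<open>None\<close> if nothing is broadcast in that slot.
\<close>

text \<open>Arrival times of a Poisson process: the interarrival times, the first one counted from
  time 0, are independent and exponentially distributed.\<close>

definition interarrival :: "(nat \<Rightarrow> 'w \<Rightarrow> real) \<Rightarrow> nat \<Rightarrow> 'w \<Rightarrow> real" where
  "interarrival A n w = A n w - (if n = 0 then 0 else A (n - 1) w)"

definition poisson_arrivals :: "'w measure \<Rightarrow> real \<Rightarrow> (nat \<Rightarrow> 'w \<Rightarrow> real) \<Rightarrow> bool" where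
  "poisson_arrivals M l A \<longleftrightarrow>
     prob_space.indep_vars M (\<lambda>_. borel) (interarrival A) UNIV \<and>
     (\<forall>n. distributed M lborel (interarrival A n) (exponential_density l))"

text \<open>Service starts immediately: a user arriving at time \<open>a\<close> already receives the chunk of the
  timeslot \<open>\<lfloor>a\<rfloor>\<close> in progress, then those of the following timeslots, each reception taking one
  time unit. At time \<open>t \<ge> a\<close> the user has thus completed \<open>\<lfloor>t - a\<rfloor>\<close> receptions. The rank is the
  row rank of the matrix whose rows are the received vectors.\<close>

definition received :: "(nat \<Rightarrow> ('f::field ^ 't) option) \<Rightarrow> real \<Rightarrow> real \<Rightarrow> ('f ^ 't) set" where
  "received c a t = {v. \<exists>j < nat \<lfloor>t - a\<rfloor>. c (nat \<lfloor>a\<rfloor> + j) = Some v}"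

definition user_rank :: "(nat \<Rightarrow> ('f::field ^ 't) option) \<Rightarrow> real \<Rightarrow> real \<Rightarrow> nat" where
  "user_rank c a t = vec.dim (received c a t)"

text \<open>A user arriving at \<open>a\<close>, if admitted, occupies its buffer slot at time \<open>t\<close>.\<close>

definition present :: "(nat \<Rightarrow> ('f::field ^ 't) option) \<Rightarrow> real \<Rightarrow> real \<Rightarrow> bool" where
  "present c a t \<longleftrightarrow> a \<le> t \<and> user_rank c a t < CARD('t)"

text \<open>The buffer, of size \<open>N\<close>, is empty initially. As requests are numbered in order of arrival,
  the users found by request \<open>n\<close> are among the requests \<open>m < n\<close>.\<close>

context
  notes conj_cong [fundef_cong]
begin

fun admitted :: "nat \<Rightarrow> (nat \<Rightarrow> ('f::field ^ 't) option) \<Rightarrow> (nat \<Rightarrow> real) \<Rightarrow> nat \<Rightarrow> bool" where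
  "admitted N c A n \<longleftrightarrow> card {m. m < n \<and> admitted N c A m \<and> present c (A m) (A n)} < N"

end

declare admitted.simps [simp del]

definition blocked :: "nat \<Rightarrow> (nat \<Rightarrow> ('f::field ^ 't) option) \<Rightarrow> (nat \<Rightarrow> real) \<Rightarrow> nat \<Rightarrow> bool" where
  "blocked N c A n \<longleftrightarrow> \<not> admitted N c A n"

definition active ::
  "nat \<Rightarrow> (nat \<Rightarrow> ('f::field ^ 't) option) \<Rightarrow> (nat \<Rightarrow> real) \<Rightarrow> nat \<Rightarrow> real \<Rightarrow> bool" where
  "active N c A m t \<longleftrightarrow> admitted N c A m \<and> present c (A m) t"

definition throughput_optimal ::
  "nat \<Rightarrow> (nat \<Rightarrow> ('f::field ^ 't) option) \<Rightarrow> (nat \<Rightarrow> real) \<Rightarrow> bool" where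
  "throughput_optimal N c A \<longleftrightarrow>
     (\<forall>m t. active N c A m t \<longrightarrow> user_rank c (A m) (t + 1) = user_rank c (A m) t + 1)"

text \<open>The blocking probability is the limit of the probability that the \<open>n\<close>-th request is
  blocked. The scheme \<open>c\<close> may depend on the sample point in an arbitrary way.\<close>

definition has_blocking_probability ::
  "'w measure \<Rightarrow> nat \<Rightarrow> ('w \<Rightarrow> nat \<Rightarrow> ('f::field ^ 't) option) \<Rightarrow> (nat \<Rightarrow> 'w \<Rightarrow> real) \<Rightarrow> real \<Rightarrow> bool"
  where
  "has_blocking_probability M N c A p \<longleftrightarrow>
     (\<lambda>n. measure M {w \<in> space M. blocked N (c w) (\<lambda>k. A k w) n}) \<longlonglongrightarrow> p"

end

theory Submission
  imports Defs
begin

text \<open>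
  Under a throughput optimal scheme an admitted user is present exactly on \<open>[a, a + T)\<close>. Departures
  thus occur in order of arrival, and the buffer is full iff the \<open>N\<close>-th most recent admitted user
  is younger than \<open>T\<close>. So the gaps between the successive admitted users, listed backwards from
  the current arrival, form a Markov chain driven by the interarrival times: a new gap is prepended
  after an admission, and the most recent one is prolonged after a blocking.

  With respect to the law of i.i.d. exponential gaps, this chain has the stationary density
  \<open>exp (- l max 0 (T - s))\<close>, where \<open>s\<close> is the sum of the first \<open>N\<close> gaps. This is the
  probability that one more gap carries the sum past \<open>T\<close>: stationarity means that the admitted users
  in the last \<open>T\<close> time units form a Poisson process conditioned to have at most \<open>N\<close> points. Erlang's
  formula is the conditional probability of exactly \<open>N\<close> points.

  Two copies of the chain driven by the same interarrival times agree after the first interarrival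
  time of length at least \<open>T\<close>, whence geometric convergence from any initial state.
\<close>

section \<open>Sojourn times and admission under throughput optimality\<close>

lemma user_rank_mono:
  assumes "t \<le> t'"
  shows "user_rank c a t \<le> user_rank c a t'"
proof -
  have "nat \<lfloor>t - a\<rfloor> \<le> nat \<lfloor>t' - a\<rfloor>"
    using assms by (intro nat_mono floor_mono) simp
  then have "received c a t \<subseteq> received c a t'"
    unfolding received_def using less_le_trans by blast
  then show ?thesis
    unfolding user_rank_def by (rule vec.dim_subset)
qed

text \<open>During \<open>[A m, A m + 1)\<close> no reception is complete, so the rank is 0. A user
  of rank \<open>k < CARD('t)\<close> at \<open>t - 1\<close> is still active there, and optimality
  yields rank \<open>k + 1\<close> at \<open>t\<close>.\<close>

lemma user_rank_throughput_optimal: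
  fixes c :: "nat \<Rightarrow> ('f::field ^ 't) option"
  assumes "throughput_optimal N c A" "admitted N c A m"
    and "k \<le> CARD('t)" "A m + real k \<le> t" "t < A m + real k + 1"
  shows "user_rank c (A m) t = k"
  using assms(3-5)
proof (induction k arbitrary: t)
  case 0
  then have "\<lfloor>t - A m\<rfloor> = 0" by linarith
  then show ?case by (simp add: user_rank_def received_def)
next
  case (Suc k)
  have r: "user_rank c (A m) (t - 1) = k"
    using Suc.prems by (intro Suc.IH) auto
  then have "active N c A m (t - 1)"
    using Suc.prems assms(2) by (auto simp: active_def present_def)
  then show ?case
    using assms(1) r by (fastforce simp: throughput_optimal_def)
qed

lemma present_iff_throughput_optimal:
  fixes c :: "nat \<Rightarrow> ('f::field ^ 't) option"
  assumes "throughput_optimal N c A" "admitted N c A m"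
  shows "present c (A m) t \<longleftrightarrow> A m \<le> t \<and> t < A m + real CARD('t)"
proof (cases "A m \<le> t \<and> t < A m + real CARD('t)")
  case True
  define k where "k = nat \<lfloor>t - A m\<rfloor>"
  have k: "A m + real k \<le> t" "t < A m + real k + 1"
    using True by (auto simp: k_def) linarith+
  then have "k < CARD('t)" using True by linarith
  then show ?thesis
    using user_rank_throughput_optimal[OF assms _ k] True by (simp add: present_def)
next
  case False
  \<comment> \<open>At \<open>A m + CARD('t)\<close> the rank is full, and monotonicity keeps it so:
    a departed user does not return.\<close>
  have "CARD('t) \<le> user_rank c (A m) t" if "A m + real CARD('t) \<le> t"
    using user_rank_throughput_optimal[OF assms, of "CARD('t)" "A m + real CARD('t)"]
      user_rank_mono[OF that, of c "A m"] by simp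
  then show ?thesis using False by (auto simp: present_def not_less)
qed

text \<open>With presence reduced to a time interval, the scheme \<open>c\<close> disappears from
  the recursion: admission is determined by the arrival times alone.\<close>

lemma admitted_throughput_optimal:
  fixes c :: "nat \<Rightarrow> ('f::field ^ 't) option"
  assumes "throughput_optimal N c A"
  shows "admitted N c A n \<longleftrightarrow>
    card {m. m < n \<and> admitted N c A m \<and> A m \<le> A n \<and> A n < A m + real CARD('t)} < N"
proof -
  have "{m. m < n \<and> admitted N c A m \<and> present c (A m) (A n)} =
      {m. m < n \<and> admitted N c A m \<and> A m \<le> A n \<and> A n < A m + real CARD('t)}"
    using present_iff_throughput_optimal[OF assms] by blast
  then show ?thesis by (subst admitted.simps) simp
qed

lemma pred_admitted_throughput_optimal:
  fixes c :: "'w \<Rightarrow> nat \<Rightarrow> ('f::field ^ 't) option"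
  assumes A [measurable]: "\<And>n. A n \<in> borel_measurable M"
    and opt: "\<And>w. w \<in> space M \<Longrightarrow> throughput_optimal N (c w) (\<lambda>k. A k w)"
  shows "Measurable.pred M (\<lambda>w. admitted N (c w) (\<lambda>k. A k w) n)"
proof (induction n rule: less_induct)
  case (less n)
  \<comment> \<open>The conjunct \<open>m < n\<close> makes \<open>B m\<close> measurable for every
    \<open>m\<close>, by the induction hypothesis.\<close>
  define B where "B m w \<longleftrightarrow> m < n \<and> admitted N (c w) (\<lambda>k. A k w) m" for m w
  have [measurable]: "Measurable.pred M (B m)" for m
    unfolding B_def[abs_def] using less.IH[of m] by (cases "m < n") simp_all
  have card: "card {m. m < n \<and> admitted N (c w) (\<lambda>k. A k w) m \<and>
      A m w \<le> A n w \<and> A n w < A m w + real CARD('t)} =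
      (\<Sum>m<n. of_bool (B m w \<and> A m w \<le> A n w \<and> A n w < A m w + real CARD('t)))" for w
  proof -
    have "{m. m < n \<and> admitted N (c w) (\<lambda>k. A k w) m \<and>
        A m w \<le> A n w \<and> A n w < A m w + real CARD('t)} =
        {..<n} \<inter> {m. B m w \<and> A m w \<le> A n w \<and> A n w < A m w + real CARD('t)}"
      by (auto simp: B_def)
    then show ?thesis by (simp only: sum_of_bool_eq finite_lessThan of_nat_id)
  qed
  have "Measurable.pred M (\<lambda>w. (\<Sum>m<n. if B m w \<and> A m w \<le> A n w \<and> A n w < A m w + real CARD('t)
      then 1 else 0) < N)"
    by measurable
  then have "Measurable.pred M (\<lambda>w. card {m. m < n \<and> admitted N (c w) (\<lambda>k. A k w) m \<and>
      A m w \<le> A n w \<and> A n w < A m w + real CARD('t)} < N)"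
    unfolding card of_bool_def .
  then show ?case
    by (rule measurable_cong[THEN iffD2, rotated]) (rule admitted_throughput_optimal[OF opt])
qed

text \<open>\<open>x\<close> is the state found by an arrival: \<open>\<Sum>i\<le>j. x i\<close> is
  the time since the \<open>j\<close>-th most recent admission, counted from 0. The test asks
  whether the buffer is full, and \<open>s\<close> is the time until the next arrival.\<close>

definition gap_step :: "nat \<Rightarrow> real \<Rightarrow> (nat \<Rightarrow> real) \<Rightarrow> real \<Rightarrow> nat \<Rightarrow> real" where
  "gap_step N \<tau> x s = (if (\<Sum>i<N. x i) < \<tau> then x(0 := x 0 + s) else case_nat s x)"

primrec gaps :: "nat \<Rightarrow> real \<Rightarrow> (nat \<Rightarrow> real) \<Rightarrow> (nat \<Rightarrow> real) \<Rightarrow> nat \<Rightarrow> nat \<Rightarrow> real" where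
  "gaps N \<tau> x s 0 = x"
| "gaps N \<tau> x s (Suc n) = gap_step N \<tau> (gaps N \<tau> x s n) (s n)"

lemma sum_gap_step:
  "(\<Sum>i\<le>j. gap_step N \<tau> x s i) =
    (if (\<Sum>i<N. x i) < \<tau> then s + (\<Sum>i\<le>j. x i)
     else case j of 0 \<Rightarrow> s | Suc i \<Rightarrow> s + (\<Sum>i\<le>i. x i))"
proof -
  have "(\<Sum>i\<le>j. (x(0 := x 0 + s)) i) = s + (\<Sum>i\<le>j. x i)"
    by (induction j) auto
  then show ?thesis
    by (auto simp: gap_step_def sum.atMost_Suc_shift simp del: sum.atMost_Suc split: nat.splits)
qed

lemma gap_step_nonneg: "(\<And>i. 0 \<le> x i) \<Longrightarrow> 0 \<le> s \<Longrightarrow> 0 \<le> gap_step N \<tau> x s i"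
  by (auto simp: gap_step_def split: nat.splits)

lemma gaps_Suc_case_nat:
  "gaps N \<tau> x (case_nat a s) (Suc n) = gaps N \<tau> (gap_step N \<tau> x a) s n"
  by (induction n) auto

text \<open>Partial sums of nonnegative terms do not decrease, so the indices counted form an
  initial segment; it has fewer than \<open>N\<close> elements iff it misses \<open>N - 1\<close>.
  Finiteness is assumed because \<open>card\<close> is 0 on infinite sets.\<close>

lemma card_partial_sums_less_iff:
  fixes x :: "nat \<Rightarrow> real"
  assumes "\<And>i. 0 \<le> x i" "finite {j. (\<Sum>i\<le>j. x i) < u}" "0 < N"
  shows "card {j. (\<Sum>i\<le>j. x i) < u} < N \<longleftrightarrow> u \<le> (\<Sum>i<N. x i)"
proof
  assume "card {j. (\<Sum>i\<le>j. x i) < u} < N"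
  then have "\<not> {..<N} \<subseteq> {j. (\<Sum>i\<le>j. x i) < u}"
    using card_mono[OF assms(2), of "{..<N}"] by auto
  then obtain j where "j < N" "u \<le> (\<Sum>i\<le>j. x i)"
    by (force simp: not_less subset_iff)
  moreover have "(\<Sum>i\<le>j. x i) \<le> (\<Sum>i<N. x i)"
    using \<open>j < N\<close> assms(1) by (intro sum_mono2) auto
  ultimately show "u \<le> (\<Sum>i<N. x i)" by simp
next
  assume *: "u \<le> (\<Sum>i<N. x i)"
  have "{j. (\<Sum>i\<le>j. x i) < u} \<subseteq> {..<N - 1}"
  proof
    fix j assume "j \<in> {j. (\<Sum>i\<le>j. x i) < u}"
    then have "(\<Sum>i\<le>j. x i) < u" by simp
    moreover have "(\<Sum>i<N. x i) \<le> (\<Sum>i\<le>j. x i)" if "N - 1 \<le> j"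
      using that assms(1,3) by (intro sum_mono2) auto
    ultimately show "j \<in> {..<N - 1}" using * by (cases "N - 1 \<le> j") auto
  qed
  then show "card {j. (\<Sum>i\<le>j. x i) < u} < N"
    using card_mono[of "{..<N - 1}" "{j. (\<Sum>i\<le>j. x i) < u}"] \<open>0 < N\<close> by simp
qed

text \<open>The empty buffer is encoded by gaps \<open>\<tau>\<close>, i.e. by fictitious users who have all departed.\<close>

lemma admitted_iff_gaps:
  fixes A :: "nat \<Rightarrow> real" and adm :: "nat \<Rightarrow> bool"
  assumes adm: "\<And>n. adm n \<longleftrightarrow> card {m. m < n \<and> adm m \<and> A m \<le> A n \<and> A n < A m + \<tau>} < N"
    and inc: "\<And>n. A n < A (Suc n)" and "0 < N" "0 < \<tau>"
  shows "adm n \<longleftrightarrow> \<tau> \<le> (\<Sum>i<N. gaps N \<tau> (\<lambda>_. \<tau>) (\<lambda>k. A (Suc k) - A k) n i)"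
proof -
  let ?W = "gaps N \<tau> (\<lambda>_. \<tau>) (\<lambda>k. A (Suc k) - A k)"
  \<comment> \<open>Two counts of users younger than \<open>u\<close>: \<open>?L\<close> uses the
    admission history, \<open>?R\<close> the partial sums of the gaps.\<close>
  let ?L = "\<lambda>n u. {m. m < n \<and> adm m \<and> A n - A m < u}"
  let ?R = "\<lambda>n u. {j. (\<Sum>i\<le>j. ?W n i) < u}"
  have mono: "A m \<le> A n" if "m < n" for m n
    using that inc by (meson lift_Suc_mono_less less_imp_le)
  have nn: "0 \<le> ?W n i" for n i
    using \<open>0 < \<tau>\<close> inc by (induction n arbitrary: i) (auto intro!: gap_step_nonneg simp: less_imp_le)
  have admW: "adm n \<longleftrightarrow> \<tau> \<le> (\<Sum>i<N. ?W n i)"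
    if "finite (?R n \<tau>)" "card (?L n \<tau>) = card (?R n \<tau>)" for n
  proof -
    have "{m. m < n \<and> adm m \<and> A m \<le> A n \<and> A n < A m + \<tau>} = ?L n \<tau>"
      using mono by auto
    then show ?thesis
      using adm[of n] that card_partial_sums_less_iff[OF nn that(1) \<open>0 < N\<close>] by simp
  qed
  \<comment> \<open>All thresholds are treated at once, since the step passes from \<open>u\<close>
    to \<open>u - s\<close>. Above \<open>\<tau>\<close> the claim would fail, as the fictitious
    initial users would be counted.\<close>
  have "\<forall>u\<le>\<tau>. finite (?R n u) \<and> card (?L n u) = card (?R n u)"
  proof (induction n)
    case 0
    have "\<tau> \<le> real (Suc j) * \<tau>" for j using \<open>0 < \<tau>\<close> by (simp add: distrib_right)
    then have "?R 0 u = {}" if "u \<le> \<tau>" for u using that by (auto simp: not_less intro: order_trans)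
    then show ?case by auto
  next
    case (Suc n)
    define s where "s = A (Suc n) - A n"
    have s: "0 < s" using inc by (simp add: s_def)
    have an: "adm n \<longleftrightarrow> \<not> (\<Sum>i<N. ?W n i) < \<tau>"
      using admW[of n] Suc.IH by auto
    have sum_Suc: "(\<Sum>i\<le>j. ?W (Suc n) i) = (if \<not> adm n then s + (\<Sum>i\<le>j. ?W n i)
        else case j of 0 \<Rightarrow> s | Suc i \<Rightarrow> s + (\<Sum>i\<le>i. ?W n i))" for j
      unfolding gaps.simps sum_gap_step an s_def by simp
    have R0: "?R n v = {}" if "v \<le> 0" for v
      using that nn by (auto simp: not_less intro!: order_trans[OF that] sum_nonneg)
    have L0: "?L n v = {}" if "v \<le> 0" for v
      using that mono by (force simp: not_less)
    show ?case
    proof (intro allI impI)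
      fix u assume u: "u \<le> \<tau>"
      have IH: "finite (?R n (u - s))" "card (?L n (u - s)) = card (?R n (u - s))"
        using Suc.IH u s by auto
      have L: "?L (Suc n) u = (if adm n \<and> s < u then insert n (?L n (u - s)) else ?L n (u - s))"
        by (auto simp: less_Suc_eq s_def algebra_simps)
      have R: "?R (Suc n) u = (if adm n then if s < u then insert 0 (Suc ` ?R n (u - s)) else {}
          else ?R n (u - s))"
      proof (cases "adm n")
        case True
        have "?R n (u - s) = {}" if "\<not> s < u" using that R0 by auto
        then have "j \<in> ?R (Suc n) u \<longleftrightarrow>
            j \<in> (if s < u then insert 0 (Suc ` ?R n (u - s)) else {})" for j
          using True unfolding sum_Suc
          by (cases j) (auto simp: image_iff algebra_simps)
        then show ?thesis using True by auto
      qed (auto simp: sum_Suc algebra_simps simp del: gaps.simps)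
      show "finite (?R (Suc n) u) \<and> card (?L (Suc n) u) = card (?R (Suc n) u)"
        unfolding L R using IH L0[of "u - s"] R0[of "u - s"]
        by (auto simp: card_image card_insert_if)
    qed
  qed
  then show ?thesis by (intro admW) auto
qed

section \<open>Equivalence of states and coalescence\<close>

text \<open>Only ages below \<open>\<tau>\<close> matter: two states are equivalent if they agree after truncation of the
  partial sums at \<open>\<tau>\<close>.\<close>

definition equiv_gaps :: "nat \<Rightarrow> real \<Rightarrow> (nat \<Rightarrow> real) \<Rightarrow> (nat \<Rightarrow> real) \<Rightarrow> bool" where
  "equiv_gaps N \<tau> x y \<longleftrightarrow>
     (\<forall>u\<le>\<tau>. \<forall>j<N. (\<Sum>i\<le>j. x i) < u \<longleftrightarrow> (\<Sum>i\<le>j. y i) < u)"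

lemma equiv_gaps_blocked:
  assumes "equiv_gaps N \<tau> x y" "0 < N"
  shows "(\<Sum>i<N. x i) < \<tau> \<longleftrightarrow> (\<Sum>i<N. y i) < \<tau>"
proof -
  have "{..<N} = {..N - 1}" using \<open>0 < N\<close> by auto
  then show ?thesis using assms by (auto simp: equiv_gaps_def)
qed

lemma equiv_gaps_step:
  assumes "equiv_gaps N \<tau> x y" "0 < N" "0 \<le> s"
  shows "equiv_gaps N \<tau> (gap_step N \<tau> x s) (gap_step N \<tau> y s)"
proof -
  have *: "s + (\<Sum>i\<le>j. x i) < u \<longleftrightarrow> s + (\<Sum>i\<le>j. y i) < u" if "j < N" "u \<le> \<tau>" for j u
  proof -
    have "u - s \<le> \<tau>" using that assms(3) by simp
    then have "(\<Sum>i\<le>j. x i) < u - s \<longleftrightarrow> (\<Sum>i\<le>j. y i) < u - s"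
      using assms(1) that(1) by (auto simp: equiv_gaps_def)
    then show ?thesis by linarith
  qed
  show ?thesis
    unfolding equiv_gaps_def sum_gap_step equiv_gaps_blocked[OF assms(1,2)]
    using * by (auto split: nat.splits)
qed

text \<open>Whichever branch is taken, all ages become at least \<open>\<tau>\<close>, so every
  comparison is false on both sides. This is where two copies of the chain merge.\<close>

lemma equiv_gaps_step_long:
  assumes "\<And>i. 0 \<le> x i" "\<And>i. 0 \<le> y i" "\<tau> \<le> s"
  shows "equiv_gaps N \<tau> (gap_step N \<tau> x s) (gap_step N \<tau> y s)"
proof -
  have "\<tau> \<le> (\<Sum>i\<le>j. gap_step N \<tau> z s i)" if "\<And>i. 0 \<le> z i" for z j
  proof -
    have "\<tau> \<le> s + (\<Sum>i\<le>k. z i)" for k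
      using assms(3) sum_nonneg[of "{..k}" z] that by auto
    then show ?thesis
      using assms(3) by (auto simp: sum_gap_step split: nat.splits)
  qed
  then have "\<not> (\<Sum>i\<le>j. gap_step N \<tau> z s i) < u" if "\<And>i. 0 \<le> z i" "u \<le> \<tau>" for z j u
    using that by (meson not_less order_trans)
  then show ?thesis using assms(1,2) by (simp add: equiv_gaps_def)
qed

section \<open>The space of gap sequences and the transition operator\<close>

locale exponential_gaps =
  fixes N :: nat and l \<tau> :: real
  assumes N_pos: "0 < N" and l_pos: "0 < l" and tau_pos: "0 < \<tau>"
begin

abbreviation P :: "real measure" where
  "P \<equiv> density lborel (exponential_density l)"

sublocale E: sequence_space P
  using prob_space_exponential_density[OF l_pos]
  by (simp add: sequence_space_def product_prob_space_def product_prob_space_axioms_def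
      product_sigma_finite_def prob_space_imp_sigma_finite)

abbreviation S :: "(nat \<Rightarrow> real) measure" where
  "S \<equiv> Pi\<^sub>M UNIV (\<lambda>_. P)"

lemma sets_S [measurable_cong]: "sets S = sets (Pi\<^sub>M UNIV (\<lambda>_. borel))"
  by (intro sets_PiM_cong) auto

lemma AE_P_nonneg: "AE s in P. 0 \<le> s"
  by (subst AE_density) (auto simp: exponential_density_def)

lemma AE_S_nonneg: "AE x in S. \<forall>i. 0 \<le> x i"
  unfolding AE_all_countable
  using E.AE_component AE_P_nonneg by auto

lemma nn_integral_P:
  assumes [measurable]: "f \<in> borel_measurable borel"
  shows "(\<integral>\<^sup>+s. f s \<partial>P) = (\<integral>\<^sup>+s. ennreal (exponential_density l s) * f s \<partial>lborel)"
  by (subst nn_integral_density) auto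

text \<open>\<open>S\<close> is the law of an \<open>S\<close>-sequence with an independent
  \<open>P\<close>-variable put in front. The first order of integration serves the stationarity
  computation, the second the recursion of the chain.\<close>

lemma nn_integral_S_iter:
  assumes [measurable]: "f \<in> borel_measurable (Pi\<^sub>M UNIV (\<lambda>_. borel))"
  shows "(\<integral>\<^sup>+x. f x \<partial>S) = (\<integral>\<^sup>+x. \<integral>\<^sup>+s. f (case_nat s x) \<partial>P \<partial>S)"
    and "(\<integral>\<^sup>+x. f x \<partial>S) = (\<integral>\<^sup>+s. \<integral>\<^sup>+x. f (case_nat s x) \<partial>S \<partial>P)"
proof -
  interpret PS: pair_sigma_finite P S ..
  have "(\<integral>\<^sup>+x. f x \<partial>S) = (\<integral>\<^sup>+x. f x \<partial>distr (P \<Otimes>\<^sub>M S) S (\<lambda>(s, x). case_nat s x))"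
    by (simp add: E.PiM_iter)
  also have "\<dots> = (\<integral>\<^sup>+z. f (case_nat (fst z) (snd z)) \<partial>(P \<Otimes>\<^sub>M S))"
    by (subst nn_integral_distr) (auto simp: split_beta')
  finally have *: "(\<integral>\<^sup>+x. f x \<partial>S) = (\<integral>\<^sup>+z. f (case_nat (fst z) (snd z)) \<partial>(P \<Otimes>\<^sub>M S))" .
  show "(\<integral>\<^sup>+x. f x \<partial>S) = (\<integral>\<^sup>+x. \<integral>\<^sup>+s. f (case_nat s x) \<partial>P \<partial>S)"
    unfolding * by (subst PS.nn_integral_snd[symmetric]) (auto simp: split_beta')
  show "(\<integral>\<^sup>+x. f x \<partial>S) = (\<integral>\<^sup>+s. \<integral>\<^sup>+x. f (case_nat s x) \<partial>S \<partial>P)"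
    unfolding * by (subst E.P.nn_integral_fst[symmetric]) auto
qed

text \<open>Isolates coordinate \<open>n\<close>: \<open>x\<close> supplies the coordinates below
  it, \<open>s\<close> is the coordinate itself, and \<open>y\<close> supplies those above.\<close>

lemma nn_integral_S_comb_seq:
  assumes [measurable]: "f \<in> borel_measurable (Pi\<^sub>M UNIV (\<lambda>_. borel))"
  shows "(\<integral>\<^sup>+x. f x \<partial>S) = (\<integral>\<^sup>+x. \<integral>\<^sup>+s. \<integral>\<^sup>+y. f (comb_seq n x (case_nat s y)) \<partial>S \<partial>P \<partial>S)"
proof -
  have "(\<integral>\<^sup>+x. f x \<partial>S) = (\<integral>\<^sup>+x. f x \<partial>distr (S \<Otimes>\<^sub>M S) S (\<lambda>(x, y). comb_seq n x y))"
    by (simp add: E.PiM_comb_seq)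
  also have "\<dots> = (\<integral>\<^sup>+z. f (comb_seq n (fst z) (snd z)) \<partial>(S \<Otimes>\<^sub>M S))"
    by (subst nn_integral_distr) (auto simp: split_beta')
  also have "\<dots> = (\<integral>\<^sup>+x. \<integral>\<^sup>+y. f (comb_seq n x y) \<partial>S \<partial>S)"
    by (subst E.P.nn_integral_fst[symmetric]) auto
  also have "\<dots> = (\<integral>\<^sup>+x. \<integral>\<^sup>+s. \<integral>\<^sup>+y. f (comb_seq n x (case_nat s y)) \<partial>S \<partial>P \<partial>S)"
  proof (rule nn_integral_cong)
    fix x :: "nat \<Rightarrow> real"
    have [measurable]: "(\<lambda>y. f (comb_seq n x y)) \<in> borel_measurable (Pi\<^sub>M UNIV (\<lambda>_. borel))"
      by (rule measurable_compose[OF measurable_comb_seq'[OF measurable_const] assms])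
        (auto simp: space_PiM)
    show "(\<integral>\<^sup>+y. f (comb_seq n x y) \<partial>S) =
        (\<integral>\<^sup>+s. \<integral>\<^sup>+y. f (comb_seq n x (case_nat s y)) \<partial>S \<partial>P)"
      by (rule nn_integral_S_iter) measurable
  qed
  finally show ?thesis .
qed

lemma measurable_gap_step [measurable]:
  assumes [measurable]: "f \<in> measurable K (Pi\<^sub>M UNIV (\<lambda>_. borel))" "g \<in> borel_measurable K"
  shows "(\<lambda>w. gap_step N \<tau> (f w) (g w)) \<in> measurable K (Pi\<^sub>M UNIV (\<lambda>_. borel))"
proof (rule measurable_PiM_single')
  fix i :: nat
  have "(\<lambda>w. if (\<Sum>i<N. f w i) < \<tau> then if i = 0 then f w 0 + g w else f w i
      else case_nat (g w) (f w) i) \<in> borel_measurable K"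
    by measurable
  moreover have "gap_step N \<tau> (f w) (g w) i = (if (\<Sum>i<N. f w i) < \<tau>
      then if i = 0 then f w 0 + g w else f w i else case_nat (g w) (f w) i)" for w
    by (simp add: gap_step_def)
  ultimately show "(\<lambda>w. gap_step N \<tau> (f w) (g w) i) \<in> borel_measurable K" by simp
qed auto

lemma measurable_gaps [measurable]:
  "(\<lambda>s. gaps N \<tau> x s n) \<in> measurable (Pi\<^sub>M UNIV (\<lambda>_. borel)) (Pi\<^sub>M UNIV (\<lambda>_. borel))"
  by (induction n) (auto simp: space_PiM)

text \<open>The transition operator of the gap chain, acting on functions of the state.\<close>

definition Q :: "((nat \<Rightarrow> real) \<Rightarrow> ennreal) \<Rightarrow> (nat \<Rightarrow> real) \<Rightarrow> ennreal" where
  "Q f x = (\<integral>\<^sup>+s. f (gap_step N \<tau> x s) \<partial>P)"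

lemma measurable_Q:
  assumes [measurable]: "f \<in> borel_measurable (Pi\<^sub>M UNIV (\<lambda>_. borel))"
  shows "Q f \<in> borel_measurable (Pi\<^sub>M UNIV (\<lambda>_. borel))"
  unfolding Q_def by measurable

lemma measurable_Q_iter:
  "f \<in> borel_measurable (Pi\<^sub>M UNIV (\<lambda>_. borel)) \<Longrightarrow>
    (Q ^^ n) f \<in> borel_measurable (Pi\<^sub>M UNIV (\<lambda>_. borel))"
  by (induction n) (auto intro: measurable_Q)

text \<open>Conditioning on the first interarrival time gives the recursion
  \<open>Q ((Q ^^ n) f)\<close>; for this the first step of the chain is split off, not the
  last.\<close>

lemma nn_integral_gaps:
  assumes [measurable]: "f \<in> borel_measurable (Pi\<^sub>M UNIV (\<lambda>_. borel))"
  shows "(\<integral>\<^sup>+s. f (gaps N \<tau> x s n) \<partial>S) = (Q ^^ n) f x"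
proof (induction n arbitrary: x)
  case 0
  then show ?case by (simp add: E.P.emeasure_space_1)
next
  case (Suc n)
  have "(\<integral>\<^sup>+s. f (gaps N \<tau> x s (Suc n)) \<partial>S) =
      (\<integral>\<^sup>+a. \<integral>\<^sup>+s. f (gaps N \<tau> x (case_nat a s) (Suc n)) \<partial>S \<partial>P)"
    by (rule nn_integral_S_iter) measurable
  also have "\<dots> = (\<integral>\<^sup>+a. (Q ^^ n) f (gap_step N \<tau> x a) \<partial>P)"
    unfolding gaps_Suc_case_nat Suc.IH ..
  finally show ?case by (simp add: Q_def[of "(Q ^^ n) f"])
qed

definition blk :: "(nat \<Rightarrow> real) \<Rightarrow> ennreal" where
  "blk x = indicator {x. (\<Sum>i<N. x i) < \<tau>} x"

lemma measurable_blk [measurable]: "blk \<in> borel_measurable (Pi\<^sub>M UNIV (\<lambda>_. borel))"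
proof -
  have "(\<lambda>x. if (\<Sum>i<N. x i) < \<tau> then 1 else 0 :: ennreal) \<in> borel_measurable (Pi\<^sub>M UNIV (\<lambda>_. borel))"
    by measurable
  then show ?thesis by (auto simp: blk_def[abs_def] indicator_def if_distrib cong: if_cong)
qed

section \<open>Coupling of two copies of the chain\<close>

lemma Q_iter_blk_equiv:
  "equiv_gaps N \<tau> x y \<Longrightarrow> (Q ^^ n) blk x = (Q ^^ n) blk y"
proof (induction n arbitrary: x y)
  case 0
  then show ?case using equiv_gaps_blocked[of N \<tau> x y] N_pos by (auto simp: blk_def indicator_def)
next
  case (Suc n)
  have "(\<integral>\<^sup>+s. (Q ^^ n) blk (gap_step N \<tau> x s) \<partial>P) = (\<integral>\<^sup>+s. (Q ^^ n) blk (gap_step N \<tau> y s) \<partial>P)"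
    by (rule nn_integral_cong_AE)
      (use AE_P_nonneg in \<open>auto intro!: Suc.IH equiv_gaps_step Suc.prems N_pos\<close>)
  then show ?case by (simp add: Q_def[of "(Q ^^ n) blk"])
qed

definition short_prob :: ennreal where
  "short_prob = emeasure P {..<\<tau>}"

text \<open>Both copies use the same interarrival times. A first one of length at least
  \<open>\<tau>\<close> merges them; a shorter one, of probability \<open>short_prob\<close>, leaves
  the bound for the remaining steps. Exchanging \<open>x\<close> and \<open>y\<close> gives the
  two-sided estimate.\<close>

lemma Q_iter_blk_le:
  assumes "\<And>i. 0 \<le> x i" "\<And>i. 0 \<le> y i"
  shows "(Q ^^ n) blk x \<le> (Q ^^ n) blk y + short_prob ^ n"
  using assms
proof (induction n arbitrary: x y)
  case 0
  then show ?case by (auto simp: blk_def indicator_def)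
next
  case (Suc n)
  note [measurable] = measurable_Q_iter
  have "(\<integral>\<^sup>+s. (Q ^^ n) blk (gap_step N \<tau> x s) \<partial>P) \<le>
      (\<integral>\<^sup>+s. (Q ^^ n) blk (gap_step N \<tau> y s) + short_prob ^ n * indicator {..<\<tau>} s \<partial>P)"
  proof (rule nn_integral_mono_AE, use AE_P_nonneg in eventually_elim)
    case (elim s)
    show ?case
    proof (cases "s < \<tau>")
      case True
      then show ?thesis
        using Suc.IH[of "gap_step N \<tau> x s" "gap_step N \<tau> y s"] elim Suc.prems
        by (simp add: gap_step_nonneg)
    next
      case False
      then show ?thesis
        using Q_iter_blk_equiv[OF equiv_gaps_step_long[of x y \<tau> s N]] Suc.prems by simp
    qed
  qed
  also have "\<dots> = (\<integral>\<^sup>+s. (Q ^^ n) blk (gap_step N \<tau> y s) \<partial>P) + short_prob ^ n * short_prob"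
    by (subst nn_integral_add) (auto simp: nn_integral_cmult short_prob_def space_PiM)
  finally show ?case by (simp add: Q_def[of "(Q ^^ n) blk"] mult.commute)
qed

section \<open>Exponential tails and the stationary density\<close>

text \<open>The probability that an exponential variable is at least \<open>r\<close>;
  \<open>max 0\<close> gives the value 1 for negative \<open>r\<close>.\<close>

definition tail :: "real \<Rightarrow> real" where
  "tail r = exp (- (l * max 0 r))"

lemma measurable_tail [measurable]: "tail \<in> borel_measurable borel"
  unfolding tail_def by measurable

lemma tail_nonneg [simp]: "0 \<le> tail r"
  by (simp add: tail_def)

lemma tail_antimono: "r \<le> r' \<Longrightarrow> tail r' \<le> tail r"
  using l_pos by (simp add: tail_def)

lemma emeasure_P_atLeast: "emeasure P {r..} = ennreal (tail r)"
proof -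
  have "emeasure P {r..} = (\<integral>\<^sup>+s. ennreal (exponential_density l s) * indicator {r..} s \<partial>lborel)"
    by (subst emeasure_density) auto
  also have "\<dots> = (\<integral>\<^sup>+s. ennreal (l * exp (- l * s)) * indicator {max 0 r..} s \<partial>lborel)"
    by (intro nn_integral_cong) (auto simp: exponential_density_def indicator_def mult_ac)
  also have "\<dots> = ennreal (0 - (- exp (- l * max 0 r)))"
  proof (rule nn_integral_FTC_atLeast)
    show "((\<lambda>x. - exp (- l * x)) \<longlongrightarrow> 0) at_top"
      using l_pos by real_asymp
  qed (use l_pos in \<open>auto intro!: derivative_eq_intros\<close>)
  finally show ?thesis by (simp add: tail_def)
qed

lemma short_prob_eq: "short_prob = ennreal (1 - exp (- (l * \<tau>)))"
proof -
  have "{..<\<tau>} = space P - {\<tau>..}" by auto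
  then have "short_prob = emeasure P (space P) - emeasure P {\<tau>..}"
    unfolding short_prob_def by (simp add: emeasure_compl emeasure_P_atLeast del: space_density)
  also have "\<dots> = ennreal 1 - ennreal (tail \<tau>)"
    using E.M.emeasure_space_1 by (simp add: emeasure_P_atLeast)
  also have "\<dots> = ennreal (1 - tail \<tau>)"
    by (rule ennreal_minus) simp
  finally show ?thesis using tau_pos by (simp add: tail_def)
qed

text \<open>Here \<open>u\<close> is the length to which a first gap \<open>a\<close> is prolonged.
  Up to a null set the integrand is \<open>l * l * exp (l * a - l * u - l * r)\<close> on
  \<open>0 \<le> a \<le> min u r\<close> and 0 elsewhere, so an explicit antiderivative is
  available.\<close>

lemma nn_integral_density_overlap:
  "(\<integral>\<^sup>+a. ennreal (exponential_density l a) * (indicator {..<r} a * ennreal (exp (- (l * (r - a))))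
      * ennreal (exponential_density l (u - a))) \<partial>lborel)
    = ennreal (exponential_density l u) * ennreal (tail (r - u) - tail r)"
    (is "?L = ?R")
proof (cases "0 \<le> u \<and> 0 < r")
  case True
  \<comment> \<open>The point \<open>a = r\<close> may lie in the closed interval but not in
    \<open>{..<r}\<close>; it is a null set.\<close>
  have "?L = (\<integral>\<^sup>+a. ennreal (l * l * exp (l * a - l * u - l * r)) * indicator {0..min u r} a \<partial>lborel)"
    using AE_lborel_singleton[of r]
  proof (intro nn_integral_cong_AE, eventually_elim)
    case (elim a)
    show ?case
    proof (cases "0 \<le> a \<and> a \<le> min u r")
      case True
      have "l * exp (- a * l) * (exp (- (l * (r - a))) * (l * exp (- (u - a) * l))) =
          l * l * (exp (- a * l) * exp (- (l * (r - a))) * exp (- (u - a) * l))"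
        by simp
      also have "\<dots> = l * l * exp (l * a - l * u - l * r)"
        unfolding exp_add[symmetric] by (simp add: algebra_simps)
      finally have "ennreal (l * exp (- a * l)) *
          (ennreal (exp (- (l * (r - a)))) * ennreal (l * exp (- (u - a) * l))) =
          ennreal (l * l * exp (l * a - l * u - l * r))"
        using l_pos by (simp flip: ennreal_mult)
      then show ?thesis
        using True elim by (simp add: exponential_density_def)
    next
      case False
      then show ?thesis by (auto simp: exponential_density_def indicator_def)
    qed
  qed
  also have "\<dots> = ennreal (l * exp (l * min u r - l * u - l * r) - l * exp (l * 0 - l * u - l * r))"
    using True l_pos
    by (intro nn_integral_FTC_Icc) (auto intro!: derivative_eq_intros)
  also have "l * exp (l * min u r - l * u - l * r) - l * exp (l * 0 - l * u - l * r) =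
      exponential_density l u * (tail (r - u) - tail r)"
    using True
    by (cases "u \<le> r") (simp_all add: exponential_density_def tail_def right_diff_distrib
        mult.assoc mult.commute[of u l] flip: exp_add)
  also have "ennreal \<dots> = ?R"
    using True l_pos by (intro ennreal_mult) (auto intro!: tail_antimono)
  finally show ?thesis .
next
  case False
  then have "?L = (\<integral>\<^sup>+a. 0 \<partial>(lborel :: real measure))"
    by (intro nn_integral_cong) (auto simp: exponential_density_def indicator_def)
  moreover have "?R = 0"
    using False by (auto simp: exponential_density_def tail_def)
  ultimately show ?thesis by simp
qed

lemma nn_integral_P_shift:
  assumes [measurable]: "F \<in> borel_measurable borel"
  shows "(\<integral>\<^sup>+s. F (a + s) \<partial>P) = (\<integral>\<^sup>+u. ennreal (exponential_density l (u - a)) * F u \<partial>lborel)"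
proof -
  have "(\<integral>\<^sup>+u. ennreal (exponential_density l (u - a)) * F u \<partial>lborel) =
      ennreal \<bar>1\<bar> * (\<integral>\<^sup>+s. ennreal (exponential_density l (a + 1 * s - a)) * F (a + 1 * s) \<partial>lborel)"
    by (rule nn_integral_real_affine) auto
  then show ?thesis by (simp add: nn_integral_P)
qed

text \<open>The balance equation for the first gap, \<open>r\<close> being what the other gaps leave
  of \<open>\<tau>\<close>. A first gap \<open>u\<close> arises either from a blocking, by
  prolonging some \<open>a < r\<close>, which contributes \<open>tail (r - u) - tail r\<close>, or
  as a fresh gap after an admission, which contributes \<open>tail r\<close>.\<close>

lemma nn_integral_P_balance:
  assumes [measurable]: "F \<in> borel_measurable borel"
  shows "(\<integral>\<^sup>+a. \<integral>\<^sup>+s. indicator {..<r} a * ennreal (tail (r - a)) * F (a + s) \<partial>P \<partial>P)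
      + ennreal (tail r) * (\<integral>\<^sup>+s. F s \<partial>P)
    = (\<integral>\<^sup>+u. ennreal (tail (r - u)) * F u \<partial>P)"
proof -
  let ?d = "\<lambda>s. ennreal (exponential_density l s)"
  let ?g = "\<lambda>a. indicator {..<r} a * ennreal (exp (- (l * (r - a))))"
  have "(\<integral>\<^sup>+a. \<integral>\<^sup>+s. indicator {..<r} a * ennreal (tail (r - a)) * F (a + s) \<partial>P \<partial>P)
    = (\<integral>\<^sup>+a. ?g a * (\<integral>\<^sup>+s. F (a + s) \<partial>P) \<partial>P)"
    by (intro nn_integral_cong, subst nn_integral_cmult)
      (auto simp: indicator_def tail_def)
  also have "\<dots> = (\<integral>\<^sup>+a. ?d a * (?g a * (\<integral>\<^sup>+u. ?d (u - a) * F u \<partial>lborel)) \<partial>lborel)"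
    unfolding nn_integral_P_shift[OF assms] by (rule nn_integral_P) measurable
  also have "\<dots> = (\<integral>\<^sup>+a. \<integral>\<^sup>+u. F u * (?d a * (?g a * ?d (u - a))) \<partial>lborel \<partial>lborel)"
    by (subst nn_integral_cmult[symmetric], measurable)+ (simp add: mult_ac)
  also have "\<dots> = (\<integral>\<^sup>+u. \<integral>\<^sup>+a. F u * (?d a * (?g a * ?d (u - a))) \<partial>lborel \<partial>lborel)"
    by (rule lborel_pair.Fubini') measurable
  also have "\<dots> = (\<integral>\<^sup>+u. F u * (?d u * ennreal (tail (r - u) - tail r)) \<partial>lborel)"
    by (subst nn_integral_cmult) (auto simp: nn_integral_density_overlap)
  finally have 1: "(\<integral>\<^sup>+a. \<integral>\<^sup>+s. indicator {..<r} a * ennreal (tail (r - a)) * F (a + s) \<partial>P \<partial>P) = \<dots>" .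
  have 2: "ennreal (tail r) * (\<integral>\<^sup>+s. F s \<partial>P) = (\<integral>\<^sup>+u. F u * (?d u * ennreal (tail r)) \<partial>lborel)"
    by (subst nn_integral_P, measurable, subst nn_integral_cmult[symmetric]) (auto simp: mult_ac)
  have "F u * (?d u * ennreal (tail (r - u) - tail r)) + F u * (?d u * ennreal (tail r))
      = ?d u * (ennreal (tail (r - u)) * F u)" for u
  proof (cases "0 \<le> u")
    case True
    then have "ennreal (tail (r - u)) = ennreal (tail (r - u) - tail r) + ennreal (tail r)"
      by (subst ennreal_plus[symmetric]) (auto intro!: tail_antimono)
    then show ?thesis by (simp add: distrib_left mult_ac)
  qed (auto simp: exponential_density_def)
  then show ?thesis
    unfolding 1 2 by (subst nn_integral_add[symmetric]) (auto simp: nn_integral_P)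
qed

definition weight :: "(nat \<Rightarrow> real) \<Rightarrow> ennreal" where
  "weight x = ennreal (tail (\<tau> - (\<Sum>i<N. x i)))"

lemma measurable_weight [measurable]: "weight \<in> borel_measurable (Pi\<^sub>M UNIV (\<lambda>_. borel))"
  unfolding weight_def[abs_def] by measurable

text \<open>Gap \<open>k\<close> is independent of the first \<open>k\<close> gaps, on which alone
  \<open>G\<close> depends, and is integrated out: it carries the sum to \<open>\<tau>\<close> with
  probability \<open>tail (\<tau> - (\<Sum>i<k. x i))\<close>.\<close>

lemma nn_integral_tail:
  assumes [measurable]: "G \<in> borel_measurable (Pi\<^sub>M UNIV (\<lambda>_. borel))"
    and G: "\<And>x y. (\<And>i. i < k \<Longrightarrow> x i = y i) \<Longrightarrow> G x = G y"
  shows "(\<integral>\<^sup>+x. indicator {\<tau>..} (\<Sum>i<Suc k. x i) * G x \<partial>S) =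
    (\<integral>\<^sup>+x. ennreal (tail (\<tau> - (\<Sum>i<k. x i))) * G x \<partial>S)"
proof -
  have sum_eq: "(\<Sum>i<Suc k. comb_seq k x (case_nat s y) i) = (\<Sum>i<k. x i) + s" for x y and s :: real
    by (simp add: comb_seq_def)
  have G_eq: "G (comb_seq k x y) = G x" for x y
    by (rule G) (simp add: comb_seq_def)
  have "(\<integral>\<^sup>+x. indicator {\<tau>..} (\<Sum>i<Suc k. x i) * G x \<partial>S) =
      (\<integral>\<^sup>+x. \<integral>\<^sup>+s. \<integral>\<^sup>+y. indicator {\<tau>..} ((\<Sum>i<k. x i) + s) * G x \<partial>S \<partial>P \<partial>S)"
    by (subst nn_integral_S_comb_seq[where n=k]) (simp_all only: sum_eq G_eq, measurable)
  also have "\<dots> = (\<integral>\<^sup>+x. \<integral>\<^sup>+s. G x * indicator {\<tau> - (\<Sum>i<k. x i)..} s \<partial>P \<partial>S)"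
    by (intro nn_integral_cong)
      (auto simp: E.P.emeasure_space_1 indicator_def)
  also have "\<dots> = (\<integral>\<^sup>+x. ennreal (tail (\<tau> - (\<Sum>i<k. x i))) * G x \<partial>S)"
    by (intro nn_integral_cong, subst nn_integral_cmult_indicator)
      (auto simp: emeasure_P_atLeast mult.commute)
  finally show ?thesis .
qed

text \<open>In a blocked state the first gap is singled out; after an admission the last of the
  \<open>N\<close> gaps drops out of view and is integrated out. Both parts become integrals over
  the same \<open>N - 1\<close> remaining gaps, and for fixed values of these the claim is the
  balance equation.\<close>

lemma weight_stationary:
  assumes [measurable]: "f \<in> borel_measurable (Pi\<^sub>M UNIV (\<lambda>_. borel))"
    and f: "\<And>x y. (\<And>i. i < N \<Longrightarrow> x i = y i) \<Longrightarrow> f x = f y"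
  shows "(\<integral>\<^sup>+x. weight x * Q f x \<partial>S) = (\<integral>\<^sup>+x. weight x * f x \<partial>S)"
proof -
  obtain k where N: "N = Suc k" using N_pos by (cases N) auto
  have sum_case: "(\<Sum>i<N. case_nat a x i) = a + (\<Sum>i<k. x i)" for a and x :: "nat \<Rightarrow> real"
    by (simp add: N sum.lessThan_Suc_shift del: sum.lessThan_Suc)
  define r where "r x = \<tau> - (\<Sum>i<k. x i)" for x :: "nat \<Rightarrow> real"
  have [measurable]: "r \<in> borel_measurable (Pi\<^sub>M UNIV (\<lambda>_. borel))"
    unfolding r_def by measurable
  have [measurable]: "(\<lambda>s. f (case_nat s x)) \<in> borel_measurable borel" for x
    by (rule measurable_compose[OF _ assms(1)])
      (rule measurable_case_nat', auto simp: space_PiM)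
  \<comment> \<open>\<open>V\<close> is the contribution of an admission, where the weight is 1, and
    \<open>g\<close> that of a blocking.\<close>
  define V where "V x = (\<integral>\<^sup>+s. f (case_nat s x) \<partial>P)" for x
  define g where "g x s = indicator {..<\<tau>} (\<Sum>i<N. x i) * weight x * f (x(0 := x 0 + s))" for x s
  have [measurable]: "(\<lambda>z. (fst z)(0 := fst z 0 + snd z))
      \<in> measurable (Pi\<^sub>M UNIV (\<lambda>_. borel) \<Otimes>\<^sub>M borel) (Pi\<^sub>M UNIV (\<lambda>_::nat. borel :: real measure))"
    by (rule measurable_fun_upd[where J=UNIV]) auto
  have [measurable]: "(\<lambda>(x, s). g x s) \<in> borel_measurable (Pi\<^sub>M UNIV (\<lambda>_. borel) \<Otimes>\<^sub>M borel)"
    unfolding g_def split_beta' by measurable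
  have [measurable]: "V \<in> borel_measurable (Pi\<^sub>M UNIV (\<lambda>_. borel))"
    unfolding V_def by measurable
  have "(\<integral>\<^sup>+x. weight x * Q f x \<partial>S) =
      (\<integral>\<^sup>+x. (\<integral>\<^sup>+s. g x s \<partial>P) + indicator {\<tau>..} (\<Sum>i<N. x i) * V x \<partial>S)"
  proof (rule nn_integral_cong)
    fix x
    show "weight x * Q f x = (\<integral>\<^sup>+s. g x s \<partial>P) + indicator {\<tau>..} (\<Sum>i<N. x i) * V x"
    proof (cases "(\<Sum>i<N. x i) < \<tau>")
      case True
      have [measurable]: "(\<lambda>s. f (x(0 := x 0 + s))) \<in> borel_measurable borel"
        by (rule measurable_compose[OF _ assms(1)])
          (rule measurable_fun_upd[where J=UNIV], auto simp: space_PiM)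
      show ?thesis
        using True unfolding Q_def g_def
        by (simp add: gap_step_def nn_integral_cmult)
    next
      case False
      then show ?thesis
        by (simp add: Q_def g_def V_def gap_step_def weight_def tail_def)
    qed
  qed
  also have "\<dots> = (\<integral>\<^sup>+x. \<integral>\<^sup>+s. g x s \<partial>P \<partial>S) + (\<integral>\<^sup>+x. indicator {\<tau>..} (\<Sum>i<N. x i) * V x \<partial>S)"
    by (rule nn_integral_add) measurable
  also have "(\<integral>\<^sup>+x. indicator {\<tau>..} (\<Sum>i<N. x i) * V x \<partial>S) = (\<integral>\<^sup>+x. ennreal (tail (r x)) * V x \<partial>S)"
    unfolding N r_def
  proof (rule nn_integral_tail)
    show "V x = V y" if "\<And>i. i < k \<Longrightarrow> x i = y i" for x y
      unfolding V_def using that by (intro nn_integral_cong f) (auto simp: N split: nat.splits)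
  qed measurable
  also have "(\<integral>\<^sup>+x. \<integral>\<^sup>+s. g x s \<partial>P \<partial>S) = (\<integral>\<^sup>+x. \<integral>\<^sup>+a. \<integral>\<^sup>+s. g (case_nat a x) s \<partial>P \<partial>P \<partial>S)"
    by (rule nn_integral_S_iter) measurable
  also have "(\<integral>\<^sup>+x. \<integral>\<^sup>+a. \<integral>\<^sup>+s. g (case_nat a x) s \<partial>P \<partial>P \<partial>S) +
      (\<integral>\<^sup>+x. ennreal (tail (r x)) * V x \<partial>S) =
      (\<integral>\<^sup>+x. (\<integral>\<^sup>+a. \<integral>\<^sup>+s. g (case_nat a x) s \<partial>P \<partial>P) + ennreal (tail (r x)) * V x \<partial>S)"
    by (rule nn_integral_add[symmetric]) measurable
  also have "\<dots> = (\<integral>\<^sup>+x. \<integral>\<^sup>+u. ennreal (tail (r x - u)) * f (case_nat u x) \<partial>P \<partial>S)"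
  proof (rule nn_integral_cong)
    fix x
    have g_case: "g (case_nat a x) s =
        indicator {..<r x} a * ennreal (tail (r x - a)) * f (case_nat (a + s) x)" for a s
    proof -
      have "(case_nat a x)(0 := case_nat a x 0 + s) = case_nat (a + s) x"
        by (auto split: nat.splits)
      then show ?thesis
        by (auto simp: g_def weight_def sum_case r_def indicator_def algebra_simps)
    qed
    show "(\<integral>\<^sup>+a. \<integral>\<^sup>+s. g (case_nat a x) s \<partial>P \<partial>P) + ennreal (tail (r x)) * V x =
        (\<integral>\<^sup>+u. ennreal (tail (r x - u)) * f (case_nat u x) \<partial>P)"
      unfolding V_def g_case by (rule nn_integral_P_balance) measurable
  qed
  also have "\<dots> = (\<integral>\<^sup>+x. \<integral>\<^sup>+u. weight (case_nat u x) * f (case_nat u x) \<partial>P \<partial>S)"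
    by (simp add: weight_def sum_case r_def algebra_simps)
  also have "\<dots> = (\<integral>\<^sup>+x. weight x * f x \<partial>S)"
    by (rule nn_integral_S_iter[symmetric]) measurable
  finally show ?thesis .
qed

section \<open>Normalisation and Erlang's formula\<close>

text \<open>The sum of \<open>k + 1\<close> independent exponential variables has an Erlang
  distribution, whose tail is the probability that a Poisson variable of mean
  \<open>l * \<tau>\<close> is at most \<open>k\<close>.\<close>

lemma emeasure_S_sum:
  "emeasure S {x \<in> space S. \<tau> \<le> (\<Sum>i<Suc k. x i)} =
    ennreal (exp (- (l * \<tau>)) * (\<Sum>n\<le>k. (l * \<tau>) ^ n / fact n))"
proof -
  have dist: "distr S borel (\<lambda>x. x i) = P" for i :: nat
    using distr_PiM_component[of UNIV "\<lambda>_. P" i] prob_space_exponential_density[OF l_pos]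
    by (simp cong: distr_cong)
  have D: "distributed S lborel (\<lambda>x. x i) (exponential_density l)" for i :: nat
    using dist[of i] l_pos
    by (auto simp: distributed_def measurable_component_singleton cong: distr_cong
        intro!: measurable_component_singleton)
  have "E.P.indep_vars (\<lambda>_. borel) (\<lambda>i x. x i) (UNIV :: nat set)"
  proof (subst E.P.indep_vars_iff_distr_eq_PiM)
    have "distr S (Pi\<^sub>M UNIV (\<lambda>_. borel)) (\<lambda>x. \<lambda>i\<in>UNIV. x i) = distr S S (\<lambda>x. x)"
      by (rule distr_cong) (auto simp: sets_S)
    then show "distr S (Pi\<^sub>M UNIV (\<lambda>_. borel)) (\<lambda>x. \<lambda>i\<in>UNIV. x i) =
        Pi\<^sub>M UNIV (\<lambda>i. distr S borel (\<lambda>x. x i))"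
      by (simp add: dist distr_id)
  qed auto
  then have "E.P.indep_vars (\<lambda>_. borel) (\<lambda>i x. x i) {..<Suc k}"
    by (rule E.P.indep_vars_subset) auto
  then have "distributed S lborel (\<lambda>x. \<Sum>i<Suc k. x i) (erlang_density (card {..<Suc k} - 1) l)"
    by (intro E.P.exponential_distributed_sum) (use l_pos D in auto)
  then have erl: "distributed S lborel (\<lambda>x. \<Sum>i<Suc k. x i) (erlang_density k l)" by simp
  have "emeasure S {x \<in> space S. \<tau> \<le> (\<Sum>i<Suc k. x i)} =
      emeasure S ((\<lambda>x. \<Sum>i<Suc k. x i) -` {\<tau>..} \<inter> space S)"
    by (intro arg_cong[where f="emeasure S"]) auto
  also have "\<dots> = (\<integral>\<^sup>+u. ennreal (erlang_density k l u) * indicator {\<tau>..} u \<partial>lborel)"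
    by (rule distributed_emeasure[OF erl]) simp
  \<comment> \<open>The tail formula applied below is for the strict inequality; the boundary point
    is null.\<close>
  also have "\<dots> = (\<integral>\<^sup>+u. ennreal (erlang_density k l u) * indicator {\<tau><..} u \<partial>lborel)"
    using AE_lborel_singleton[of \<tau>]
    by (intro nn_integral_cong_AE, eventually_elim) (auto simp: indicator_def)
  also have "\<dots> = emeasure S ((\<lambda>x. \<Sum>i<Suc k. x i) -` {\<tau><..} \<inter> space S)"
    by (rule distributed_emeasure[OF erl, symmetric]) simp
  also have "\<dots> = emeasure S {x \<in> space S. \<tau> < (\<Sum>i<Suc k. x i)}"
    by (intro arg_cong[where f="emeasure S"]) auto
  also have "\<dots> = ennreal (1 - erlang_CDF k l \<tau>)"
    unfolding E.P.emeasure_eq_measure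
    using E.P.erlang_distributed_gt[OF erl l_pos, of \<tau>] tau_pos by simp
  also have "1 - erlang_CDF k l \<tau> = exp (- (l * \<tau>)) * (\<Sum>n\<le>k. (l * \<tau>) ^ n / fact n)"
    using tau_pos by (simp add: erlang_CDF_def sum_distrib_left mult_ac)
  finally show ?thesis .
qed

text \<open>Provides, for the iterates of \<open>Q\<close>, the dependence on \<open>N\<close>
  coordinates that \<open>weight_stationary\<close> asks for.\<close>

lemma Q_iter_blk_cong:
  assumes "\<And>i. i < N \<Longrightarrow> x i = y i"
  shows "(Q ^^ n) blk x = (Q ^^ n) blk y"
proof (rule Q_iter_blk_equiv)
  have "(\<Sum>i\<le>j. x i) = (\<Sum>i\<le>j. y i)" if "j < N" for j
    using that assms by (intro sum.cong) auto
  then show "equiv_gaps N \<tau> x y" by (simp add: equiv_gaps_def)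
qed

lemma weight_stationary_iter:
  "(\<integral>\<^sup>+x. weight x * (Q ^^ n) blk x \<partial>S) = (\<integral>\<^sup>+x. weight x * blk x \<partial>S)"
proof (induction n)
  case (Suc n)
  have "(\<integral>\<^sup>+x. weight x * Q ((Q ^^ n) blk) x \<partial>S) = (\<integral>\<^sup>+x. weight x * (Q ^^ n) blk x \<partial>S)"
    using Q_iter_blk_cong by (intro weight_stationary measurable_Q_iter measurable_blk) blast
  then show ?case using Suc.IH by simp
qed simp

lemma nn_integral_S_tail_sum:
  "(\<integral>\<^sup>+x. indicator {\<tau>..} (\<Sum>i<Suc k. x i) \<partial>S) =
    ennreal (exp (- (l * \<tau>)) * (\<Sum>n\<le>k. (l * \<tau>) ^ n / fact n))"
proof -
  have "(\<integral>\<^sup>+x. indicator {\<tau>..} (\<Sum>i<Suc k. x i) \<partial>S) =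
      (\<integral>\<^sup>+x. indicator {x \<in> space S. \<tau> \<le> (\<Sum>i<Suc k. x i)} x \<partial>S)"
    by (intro nn_integral_cong) (auto simp: indicator_def)
  also have "\<dots> = emeasure S {x \<in> space S. \<tau> \<le> (\<Sum>i<Suc k. x i)}"
    by (intro nn_integral_indicator) measurable
  finally show ?thesis by (simp only: emeasure_S_sum)
qed

text \<open>Read backwards, integrating out a gap turns the weight into the event that
  \<open>N + 1\<close> gaps reach \<open>\<tau>\<close>.\<close>

lemma nn_integral_weight:
  "(\<integral>\<^sup>+x. weight x \<partial>S) = ennreal (exp (- (l * \<tau>)) * (\<Sum>n\<le>N. (l * \<tau>) ^ n / fact n))"
  using nn_integral_tail[of "\<lambda>_. 1" N] by (simp add: weight_def nn_integral_S_tail_sum del: sum.lessThan_Suc)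

text \<open>Off the blocked states the weight is 1, so they contribute the probability that
  \<open>N\<close> gaps reach \<open>\<tau>\<close>, a Poisson sum up to \<open>N - 1\<close>. Of
  the total mass the term with index \<open>N\<close> remains.\<close>

lemma nn_integral_weight_blk:
  "(\<integral>\<^sup>+x. weight x * blk x \<partial>S) = ennreal (exp (- (l * \<tau>)) * ((l * \<tau>) ^ N / fact N))"
proof -
  obtain k where N: "N = Suc k" using N_pos by (cases N) auto
  let ?C = "exp (- (l * \<tau>)) * (\<Sum>n\<le>k. (l * \<tau>) ^ n / fact n)"
  have C: "0 \<le> ?C"
    using l_pos tau_pos by (intro mult_nonneg_nonneg sum_nonneg) auto
  have "(\<integral>\<^sup>+x. weight x \<partial>S) = (\<integral>\<^sup>+x. weight x * blk x + indicator {\<tau>..} (\<Sum>i<N. x i) \<partial>S)"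
    by (intro nn_integral_cong) (auto simp: weight_def blk_def indicator_def tail_def)
  also have "\<dots> = (\<integral>\<^sup>+x. weight x * blk x \<partial>S) + (\<integral>\<^sup>+x. indicator {\<tau>..} (\<Sum>i<N. x i) \<partial>S)"
    by (rule nn_integral_add) measurable
  also have "(\<integral>\<^sup>+x. indicator {\<tau>..} (\<Sum>i<N. x i) \<partial>S) = ennreal ?C"
    unfolding N by (rule nn_integral_S_tail_sum)
  finally have "(\<integral>\<^sup>+x. weight x * blk x \<partial>S) + ennreal ?C =
      ennreal (exp (- (l * \<tau>)) * ((l * \<tau>) ^ N / fact N) + ?C)"
    unfolding nn_integral_weight by (simp add: N distrib_left add.commute)
  also have "\<dots> = ennreal (exp (- (l * \<tau>)) * ((l * \<tau>) ^ N / fact N)) + ennreal ?C"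
    using l_pos tau_pos C by (intro ennreal_plus) auto
  finally show ?thesis
    using ennreal_add_left_cancel[of "ennreal ?C"] by (simp add: add.commute)
qed

section \<open>Geometric convergence from the empty buffer\<close>

text \<open>The coupling bound between the empty buffer and a state \<open>x\<close> is integrated
  against \<open>weight\<close>. By stationarity the integral of \<open>(Q ^^ n) blk\<close> does
  not depend on \<open>n\<close>.\<close>

lemma Q_iter_blk_bound:
  assumes p: "(Q ^^ n) blk (\<lambda>_. \<tau>) = ennreal p" "0 \<le> p"
  shows "\<bar>p - ((l * \<tau>) ^ N / fact N) / (\<Sum>i\<le>N. (l * \<tau>) ^ i / fact i)\<bar> \<le> (1 - exp (- (l * \<tau>))) ^ n"
proof -
  define q where "q = 1 - exp (- (l * \<tau>))"
  \<comment> \<open>\<open>Z\<close> is the total mass of \<open>weight\<close> and \<open>D\<close>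
    its mass on the blocked states; the exponential factor cancels in \<open>D / Z\<close>, which
    leaves Erlang's formula.\<close>
  define Z where "Z = exp (- (l * \<tau>)) * (\<Sum>n\<le>N. (l * \<tau>) ^ n / fact n)"
  define D where "D = exp (- (l * \<tau>)) * ((l * \<tau>) ^ N / fact N)"
  have q: "0 \<le> q" "short_prob ^ n = ennreal (q ^ n)"
    using l_pos tau_pos by (simp_all add: q_def short_prob_eq ennreal_power)
  have Z: "0 < Z"
    using l_pos tau_pos unfolding Z_def by (intro mult_pos_pos sum_pos) auto
  have D: "0 \<le> D" using l_pos tau_pos by (simp add: D_def)
  have weight_int: "(\<integral>\<^sup>+x. weight x \<partial>S) = ennreal Z" "(\<integral>\<^sup>+x. weight x * blk x \<partial>S) = ennreal D"
    by (simp_all only: nn_integral_weight nn_integral_weight_blk Z_def D_def)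
  note [measurable] = measurable_Q_iter
  have "(\<integral>\<^sup>+x. weight x * ennreal p \<partial>S) \<le> (\<integral>\<^sup>+x. weight x * (Q ^^ n) blk x + weight x * ennreal (q ^ n) \<partial>S)"
  proof (rule nn_integral_mono_AE, use AE_S_nonneg in eventually_elim)
    case (elim x)
    then have "ennreal p \<le> (Q ^^ n) blk x + ennreal (q ^ n)"
      using Q_iter_blk_le[of "\<lambda>_. \<tau>" x n] tau_pos by (simp add: p q)
    then show ?case by (simp add: mult_left_mono flip: distrib_left)
  qed
  also have "\<dots> = ennreal D + ennreal Z * ennreal (q ^ n)"
    by (subst nn_integral_add)
      (auto simp: nn_integral_multc weight_stationary_iter weight_int)
  also have "\<dots> = ennreal (D + Z * q ^ n)"
    using Z D q by (simp add: ennreal_mult)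
  finally have "ennreal (Z * p) \<le> ennreal (D + Z * q ^ n)"
    using Z p by (simp add: nn_integral_multc weight_int ennreal_mult)
  then have upper: "Z * p \<le> D + Z * q ^ n"
    using Z D q by (subst (asm) ennreal_le_iff) auto
  have "(\<integral>\<^sup>+x. weight x * (Q ^^ n) blk x \<partial>S) \<le> (\<integral>\<^sup>+x. weight x * ennreal (p + q ^ n) \<partial>S)"
  proof (rule nn_integral_mono_AE, use AE_S_nonneg in eventually_elim)
    case (elim x)
    then have "(Q ^^ n) blk x \<le> ennreal p + ennreal (q ^ n)"
      using Q_iter_blk_le[of x "\<lambda>_. \<tau>" n] tau_pos by (simp add: p q)
    then show ?case using p q by (simp add: mult_left_mono)
  qed
  then have "ennreal D \<le> ennreal (Z * (p + q ^ n))"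
    using Z p q by (simp add: weight_stationary_iter weight_int nn_integral_multc ennreal_mult
        del: ennreal_plus)
  then have lower: "D \<le> Z * (p + q ^ n)"
    using Z p q by (subst (asm) ennreal_le_iff) auto
  have "\<bar>p - D / Z\<bar> \<le> q ^ n"
    using upper lower Z by (auto simp: abs_le_iff field_simps)
  then show ?thesis by (simp add: D_def Z_def q_def)
qed

end

section \<open>Transfer to Poisson arrivals\<close>

theorem lemma3:
  fixes M :: "'w measure"
    and l :: real
    and N T :: nat
    and A :: "nat \<Rightarrow> 'w \<Rightarrow> real"
    and c :: "'w \<Rightarrow> nat \<Rightarrow> ('f::field ^ 't) option"
  assumes "prob_space M"
    and "0 < l"
    and "T = CARD('t)"
    and "poisson_arrivals M l A"
    and "\<And>w. w \<in> space M \<Longrightarrow> throughput_optimal N (c w) (\<lambda>k. A k w)"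
  shows "has_blocking_probability M N c A
           (((l * real T) ^ N / fact N) / (\<Sum>i = 0..N. (l * real T) ^ i / fact i))"
proof (cases "N = 0")
  case True
  \<comment> \<open>No cardinality is below \<open>N = 0\<close>, so every request is blocked, and
    the formula evaluates to 1.\<close>
  have "blocked N (c w) (\<lambda>k. A k w) n" for w n
    unfolding blocked_def by (subst admitted.simps) (simp add: True)
  then show ?thesis
    using prob_space.prob_space[OF assms(1)] by (simp add: has_blocking_probability_def True)
next
  case False
  interpret M: prob_space M by fact
  interpret exponential_gaps N l "real T"
    using False assms(2,3) by unfold_locales auto
  let ?X = "interarrival A"
  have indep: "M.indep_vars (\<lambda>_. borel) ?X UNIV"
    and D: "distributed M lborel (?X n) (exponential_density l)" for n
    using assms(4) by (auto simp: poisson_arrivals_def)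
  have [measurable]: "?X n \<in> borel_measurable M" for n
    using distributed_measurable[OF D] by simp
  have A_Suc: "A (Suc n) w - A n w = ?X (Suc n) w" for n w
    by (simp add: interarrival_def)
  have A_sum: "A n = (\<lambda>w. \<Sum>i\<le>n. ?X i w)" for n
  proof
    show "A n w = (\<Sum>i\<le>n. ?X i w)" for w
      by (induction n) (simp_all add: interarrival_def)
  qed
  have [measurable]: "A n \<in> borel_measurable M" for n
    by (subst A_sum) measurable
  have [measurable]: "Measurable.pred M (\<lambda>w. blocked N (c w) (\<lambda>k. A k w) n)" for n
    unfolding blocked_def
    using pred_admitted_throughput_optimal[of A M N c n] assms(5) by simp
  \<comment> \<open>Strict positivity makes the arrival times strictly increasing. The density does
    not vanish at 0, so this point is discarded as a null set.\<close>
  have "AE w in M. 0 < ?X n w" for n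
  proof -
    have "AE x in distr M lborel (?X n). 0 < x"
      unfolding distributed_distr_eq_density[OF D]
      by (subst AE_density, simp, use AE_lborel_singleton[of 0] in eventually_elim)
        (auto simp: exponential_density_def)
    then show ?thesis by (rule AE_distrD[rotated]) simp
  qed
  then have pos: "AE w in M. \<forall>n. 0 < ?X n w" by (simp add: AE_all_countable)
  \<comment> \<open>The chain starts at request 0; its step \<open>n\<close> uses the time between
    requests \<open>n\<close> and \<open>n + 1\<close>, which is interarrival time
    \<open>n + 1\<close>.\<close>
  let ?Y = "\<lambda>w i. ?X (Suc i) w"
  have distr_X: "distr M borel (?X n) = P" for n
    using distributed_distr_eq_density[OF D[of n]] by (simp cong: distr_cong)
  have "distr M (Pi\<^sub>M UNIV (\<lambda>_. borel)) (\<lambda>w. \<lambda>i\<in>UNIV. ?X i w) =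
      Pi\<^sub>M UNIV (\<lambda>i. distr M borel (?X i))"
    using indep by (subst (asm) M.indep_vars_iff_distr_eq_PiM) auto
  then have distr_X: "distr M (Pi\<^sub>M UNIV (\<lambda>_. borel)) (\<lambda>w i. ?X i w) = S"
    by (simp add: distr_X restrict_def)
  have [measurable]: "(\<lambda>w i. ?X i w) \<in> measurable M (Pi\<^sub>M UNIV (\<lambda>_. borel))"
    by (rule measurable_PiM_single') auto
  have [measurable]: "(\<lambda>x i. x (Suc i)) \<in>
      measurable (Pi\<^sub>M UNIV (\<lambda>_. borel)) (Pi\<^sub>M UNIV (\<lambda>_. borel :: real measure))"
    by (rule measurable_PiM_single') auto
  define p where "p n = measure M {w \<in> space M. blocked N (c w) (\<lambda>k. A k w) n}" for n
  have "(Q ^^ n) blk (\<lambda>_. real T) = ennreal (p n)" for n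
  proof -
    let ?W = "\<lambda>s. gaps N (real T) (\<lambda>_. real T) s n"
    \<comment> \<open>An extra variable \<open>a\<close> is integrated in at the front, so that the
      integral runs over the law of all interarrival times, of which the chain reads those from
      index 1 on.\<close>
    have "(Q ^^ n) blk (\<lambda>_. real T) = (\<integral>\<^sup>+a. \<integral>\<^sup>+s. blk (?W (\<lambda>i. case_nat a s (Suc i))) \<partial>S \<partial>P)"
      using E.M.emeasure_space_1 by (simp add: nn_integral_gaps)
    also have "\<dots> = (\<integral>\<^sup>+s. blk (?W (\<lambda>i. s (Suc i))) \<partial>S)"
      by (rule nn_integral_S_iter(2)[symmetric]) measurable
    also have "\<dots> = (\<integral>\<^sup>+w. blk (?W (?Y w)) \<partial>M)"
      unfolding distr_X[symmetric] by (rule nn_integral_distr) measurable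
    also have "\<dots> = (\<integral>\<^sup>+w. indicator {w \<in> space M. blocked N (c w) (\<lambda>k. A k w) n} w \<partial>M)"
    proof (rule nn_integral_cong_AE, use pos AE_space in eventually_elim)
      case (elim w)
      have "admitted N (c w) (\<lambda>k. A k w) n \<longleftrightarrow> real T \<le> (\<Sum>i<N. ?W (\<lambda>k. A (Suc k) w - A k w) i)"
      proof (rule admitted_iff_gaps)
        show "A n w < A (Suc n) w" for n
          using elim(1)[rule_format, of "Suc n"] A_Suc[of n w] by linarith
        show "admitted N (c w) (\<lambda>k. A k w) n \<longleftrightarrow> card {m. m < n \<and> admitted N (c w) (\<lambda>k. A k w) m \<and>
            A m w \<le> A n w \<and> A n w < A m w + real T} < N" for n
          unfolding assms(3) by (rule admitted_throughput_optimal) (use assms(5) elim in simp)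
      qed (use N_pos tau_pos in auto)
      then show ?case
        using elim by (auto simp: A_Suc blocked_def blk_def indicator_def)
    qed
    also have "\<dots> = ennreal (p n)"
      by (simp add: p_def M.emeasure_eq_measure)
    finally show ?thesis .
  qed
  then have bound: "\<bar>p n - ((l * real T) ^ N / fact N) / (\<Sum>i\<le>N. (l * real T) ^ i / fact i)\<bar>
      \<le> (1 - exp (- (l * real T))) ^ n" for n
    by (rule Q_iter_blk_bound) (simp add: p_def)
  have lim: "(\<lambda>n. (1 - exp (- (l * real T))) ^ n) \<longlonglongrightarrow> 0"
    using l_pos tau_pos by (intro LIMSEQ_power_zero) simp
  have "(\<lambda>n. p n - ((l * real T) ^ N / fact N) / (\<Sum>i\<le>N. (l * real T) ^ i / fact i)) \<longlonglongrightarrow> 0"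
    by (rule Lim_null_comparison[OF _ lim], rule always_eventually) (simp only: real_norm_def bound simp_thms)
  then have "p \<longlonglongrightarrow> ((l * real T) ^ N / fact N) / (\<Sum>i\<le>N. (l * real T) ^ i / fact i)"
    by (rule LIM_zero_cancel)
  then show ?thesis
    by (simp add: has_blocking_probability_def p_def[abs_def] atMost_atLeast0)
qed

end
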